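(* Let $0<\delta<\pi$. Let $\rho\in L^1([-\delta,\delta])$ be nonnegative and not almost everywhere zero, and let $R_X$ be of the form $$R_X(t,\tau)=\int_{-\delta}^{\delta}e^{i(t-\tau)\xi}\rho(\xi)\,d\xi,\qquad t,\tau\in\mathbb{R}.$$ Then for all $n\in\mathbb{N}$ with $n\ge \frac{4}{\pi-\delta}$, $$\mathcal{E}_n(R_X)\le \|\rho\|_{L^1([-\delta,\delta])}^{1/2}\,\frac{11e}{10\sqrt{\pi}}\left(\frac{\sqrt{\pi-\delta}}{2}+\frac{2\sqrt{2}}{\sqrt{\pi-\delta}}\right)\frac1{\sqrt{n}}\exp\left(-\frac{\pi-\delta}{2}n\right).$$
   Context: $\mathbb{N}$ denotes the positive integers and $J_n:=\{j\in\mathbb{Z}:-n+1\le j\le n\}$. $R_X$ is the autocorrelation function $R_X(t,\tau)=\int_\Omega X(t,\omega)\overline{X(\tau,\omega)}\,dP(\omega)$ of a wide sense stationary random process $X$ (one with $X(t,\cdot)\in L^2(\Omega,dP)$ for all $t$ and $R_X(t,\tau)$ depending only on $t-\tau$); only the kernel $R_X$ enters the statement. For a positive-definite kernel $K:\mathbb{R}\times\mathbb{R}\to\mathbb{C}$ (all matrices $[K(t_j,t_k)]$ over finitely many distinct points hermitian positive semi-definite), $\mathcal{H}_K$ denotes the unique reproducing kernel Hilbert space of functions on $\mathbb{R}$ with $K(t,\cdot)\in\mathcal{H}_K$ and $f(t)=\langle f,K(t,\cdot)\rangle_{\mathcal{H}_K}$ for all $f\in\mathcal{H}_K$, $t\in\mathbb{R}$.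 $U(\mathcal{H})$ is the closed unit ball of a Hilbert space $\mathcal{H}$, and $\mathbb{C}^{J_n}$ the set of functions $J_n\to\mathbb{C}$. For a continuous translation-invariant kernel $K$ and a mapping $\mathcal{A}:\mathbb{C}^{J_n}\to L^\infty([0,1])$, put $\mathcal{E}_n(\mathcal{A},K):=\sup\{\|f-\mathcal{A}(f|_{J_n})\|_{L^\infty([0,1])}:f\in U(\mathcal{H}_K)\}$ and $\mathcal{E}_n(K):=\inf_{\mathcal{A}}\mathcal{E}_n(\mathcal{A},K)$, the infimum over all such mappings $\mathcal{A}$. It is known (and may be used as an equivalent definition) that $\mathcal{E}_n(K)=\sup\{\|f\|_{L^\infty([0,1])}:f\in U(\mathcal{H}_K),\ f(j)=0\ \forall j\in J_n\}$. *)

theory Defs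
  imports "HOL-Probability.Probability"
begin

subsection \<open>Wide sense stationary processes\<close>

definition autocorrelation ::
    "'w measure \<Rightarrow> (real \<Rightarrow> 'w \<Rightarrow> complex) \<Rightarrow> real \<Rightarrow> real \<Rightarrow> complex" where
  "autocorrelation P X t \<tau> = (LINT \<omega>|P. X t \<omega> * cnj (X \<tau> \<omega>))"

definition wide_sense_stationary :: "'w measure \<Rightarrow> (real \<Rightarrow> 'w \<Rightarrow> complex) \<Rightarrow> bool" where
  "wide_sense_stationary P X \<longleftrightarrow>
     prob_space P \<and>
     (\<forall>t. X t \<in> borel_measurable P \<and> integrable P (\<lambda>\<omega>. (norm (X t \<omega>))\<^sup>2)) \<and>
     (\<exists>r. \<forall>t \<tau>. autocorrelation P X t \<tau> = r (t - \<tau>))"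

subsection \<open>Reproducing kernel Hilbert spaces\<close>

definition ip_norm :: "('f \<Rightarrow> 'f \<Rightarrow> complex) \<Rightarrow> 'f \<Rightarrow> real" where
  "ip_norm ip f = sqrt (Re (ip f f))"

text \<open>
  A complex Hilbert space whose elements are functions, given by its carrier \<open>H\<close> and its inner
  product \<open>ip\<close> (linear in the first argument). The values of \<open>ip\<close> outside \<open>H\<close> are irrelevant.
\<close>

definition hilbert_function_space ::
    "('x \<Rightarrow> complex) set \<Rightarrow> (('x \<Rightarrow> complex) \<Rightarrow> ('x \<Rightarrow> complex) \<Rightarrow> complex) \<Rightarrow> bool" where
  "hilbert_function_space H ip \<longleftrightarrow>
     (\<lambda>x. 0) \<in> H \<and>
     (\<forall>f\<in>H. \<forall>g\<in>H. (\<lambda>x. f x + g x) \<in> H) \<and>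
     (\<forall>a. \<forall>f\<in>H. (\<lambda>x. a * f x) \<in> H) \<and>
     (\<forall>f\<in>H. \<forall>g\<in>H. \<forall>h\<in>H. ip (\<lambda>x. f x + g x) h = ip f h + ip g h) \<and>
     (\<forall>a. \<forall>f\<in>H. \<forall>g\<in>H. ip (\<lambda>x. a * f x) g = a * ip f g) \<and>
     (\<forall>f\<in>H. \<forall>g\<in>H. ip g f = cnj (ip f g)) \<and>
     (\<forall>f\<in>H. f \<noteq> (\<lambda>x. 0) \<longrightarrow> Re (ip f f) > 0) \<and>
     (\<forall>F :: nat \<Rightarrow> 'x \<Rightarrow> complex. range F \<subseteq> H \<and>
        (\<forall>\<epsilon>>0. \<exists>N. \<forall>m\<ge>N. \<forall>n\<ge>N. ip_norm ip (\<lambda>x. F m x - F n x) < \<epsilon>) \<longrightarrow>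
        (\<exists>f\<in>H. (\<lambda>n. ip_norm ip (\<lambda>x. F n x - f x)) \<longlonglongrightarrow> 0))"

text \<open>
  \<open>is_rkhs K H ip\<close> says that \<open>(H, ip)\<close> is the reproducing kernel Hilbert space of \<open>K\<close>. For a
  positive-definite \<open>K\<close> such a space exists and is unique (Moore--Aronszajn), the inner product
  being unique on \<open>H\<close>; quantities depending on the space of \<open>K\<close> therefore take \<open>(H, ip)\<close> as
  parameters.
\<close>

definition is_rkhs ::
    "('x \<Rightarrow> 'x \<Rightarrow> complex) \<Rightarrow> ('x \<Rightarrow> complex) set \<Rightarrow>
     (('x \<Rightarrow> complex) \<Rightarrow> ('x \<Rightarrow> complex) \<Rightarrow> complex) \<Rightarrow> bool" where
  "is_rkhs K H ip \<longleftrightarrow>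
     hilbert_function_space H ip \<and>
     (\<forall>t. K t \<in> H) \<and>
     (\<forall>f\<in>H. \<forall>t. f t = ip f (K t))"

definition unit_ball ::
    "('x \<Rightarrow> complex) set \<Rightarrow> (('x \<Rightarrow> complex) \<Rightarrow> ('x \<Rightarrow> complex) \<Rightarrow> complex) \<Rightarrow>
     ('x \<Rightarrow> complex) set" where
  "unit_ball H ip = {f \<in> H. ip_norm ip f \<le> 1}"

subsection \<open>Minimal sampling errors\<close>

definition J :: "nat \<Rightarrow> int set" where
  "J n = {- int n + 1..int n}"

text \<open>
  The norm of \<open>L\<^sup>\<infinity>([0,1])\<close>. Finiteness gives measurability of the modulus of \<open>g\<close> only (\<open>esssup\<close> of a
  non-measurable function is \<open>top\<close>), so \<open>Linf\<close> demands measurability of \<open>g\<close> separately.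
\<close>

definition Linf_norm :: "(real \<Rightarrow> complex) \<Rightarrow> ennreal" where
  "Linf_norm g = esssup (lebesgue_on {0..1}) (\<lambda>t. ennreal (norm (g t)))"

definition Linf :: "(real \<Rightarrow> complex) set" where
  "Linf = {g \<in> borel_measurable (lebesgue_on {0..1}). Linf_norm g < \<infinity>}"

text \<open>
  Elements of \<open>\<complex>\<^bsup>J\<^sub>n\<^esup>\<close> are the functions in \<open>J n \<rightarrow>\<^sub>E UNIV\<close>. The mappings
  \<open>\<complex>\<^bsup>J\<^sub>n\<^esup> \<rightarrow> L\<^sup>\<infinity>([0,1])\<close> are arbitrary, in particular not required to be linear or continuous.
\<close>

definition sampling_maps :: "nat \<Rightarrow> ((int \<Rightarrow> complex) \<Rightarrow> real \<Rightarrow> complex) set" where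
  "sampling_maps n = {A. \<forall>c \<in> J n \<rightarrow>\<^sub>E UNIV. A c \<in> Linf}"

definition samples :: "nat \<Rightarrow> (real \<Rightarrow> complex) \<Rightarrow> int \<Rightarrow> complex" where
  "samples n f = restrict (\<lambda>j. f (of_int j)) (J n)"

definition sampling_error ::
    "(real \<Rightarrow> complex) set \<Rightarrow> ((real \<Rightarrow> complex) \<Rightarrow> (real \<Rightarrow> complex) \<Rightarrow> complex) \<Rightarrow> nat \<Rightarrow>
     ((int \<Rightarrow> complex) \<Rightarrow> real \<Rightarrow> complex) \<Rightarrow> ennreal" where
  "sampling_error H ip n A =
     (SUP f \<in> unit_ball H ip. Linf_norm (\<lambda>t. f t - A (samples n f) t))"

definition minimal_sampling_error ::
    "(real \<Rightarrow> complex) set \<Rightarrow> ((real \<Rightarrow> complex) \<Rightarrow> (real \<Rightarrow> complex) \<Rightarrow> complex) \<Rightarrow> nat \<Rightarrow>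
     ennreal" where
  "minimal_sampling_error H ip n = (INF A \<in> sampling_maps n. sampling_error H ip n A)"

end

theory Submission
  imports Defs "HOL-Complex_Analysis.Complex_Analysis" "HOL-Real_Asymp.Real_Asymp"
begin

text \<open>
  Write \<open>\<epsilon> = \<pi> - \<delta>\<close>. The Gaussian-regularised Shannon series
  \<open>A f t = (\<Sum>j\<in>J n. sinc (\<pi> (t - j)) exp (- \<alpha> (t - j)\<^sup>2) f j)\<close> with \<open>\<alpha> = \<epsilon> / (2 n)\<close> is an
  admissible sampling map, so its error bounds the infimum over all such maps.

  \<^emph>\<open>Reduction to exponentials.\<close> A finite combination of point evaluations is a functional on the
  reproducing kernel Hilbert space. By Cauchy--Schwarz and the spectral form of the kernel, the
  norm of \<open>f \<mapsto> \<Sum>i. a i f (s i)\<close> is the \<open>L\<^sup>2(\<rho>)\<close> norm of its symbol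
  \<open>\<xi> \<mapsto> \<Sum>i. a i exp (- \<i> s i \<xi>)\<close>, hence at most \<open>sqrt \<parallel>\<rho>\<parallel>\<^sub>1\<close> times the supremum of the symbol over
  \<open>\<bar>\<xi>\<bar> \<le> \<delta>\<close> (lemma \<open>spectral_rkhs_functional_le\<close>). Applied to \<open>f \<mapsto> f t - A f t\<close>, this leaves a uniform
  estimate for the error of the sampling series on the pure frequencies \<open>exp (\<i> \<xi> t)\<close>, \<open>\<bar>\<xi>\<bar> \<le> \<delta>\<close>.
  Applied to \<open>f \<mapsto> f t - f u\<close>, it shows that the elements of the space are Lipschitz continuous,
  so that the essential suprema are those of measurable functions.

  \<^emph>\<open>Pure frequencies.\<close> The residue theorem expresses the error of the series over \<open>J N\<close> as
  \<open>sin (\<pi> t) / (2 \<pi> \<i>)\<close> times the integral of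
  \<open>exp (\<i> \<xi> z - \<alpha> (z - t)\<^sup>2) / ((z - t) sin (\<pi> z))\<close> around the rectangle with real part between
  \<open>1/2 - N\<close> and \<open>N + 1/2\<close> and imaginary part between \<open>- Y\<close> and \<open>Y\<close> (lemma
  \<open>sampling_remainder_contour\<close>). On the horizontal sides the integrand has size
  \<open>exp (\<alpha> Y\<^sup>2 - \<epsilon> Y) exp (- \<alpha> (x - t)\<^sup>2) / Y\<close> up to a constant, and the Gaussian in \<open>x\<close> is integrable.
  The vertical sides contribute nothing in the limit \<open>N \<rightarrow> \<infinity>\<close>. The terms with index outside \<open>J n\<close>
  are at distance at least \<open>n\<close> from \<open>t \<in> [0, 1]\<close>, so the Gaussian makes their sum of size
  \<open>exp (- \<alpha> n\<^sup>2) / n\<close> (lemma \<open>gauss_sinc_tail\<close>). Choosing \<open>Y = n\<close> and \<open>\<alpha> = \<epsilon> / (2 n)\<close> makes both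
  exponents, \<open>\<alpha> Y\<^sup>2 - \<epsilon> Y\<close> and \<open>- \<alpha> n\<^sup>2\<close>, equal to \<open>- \<epsilon> n / 2\<close>.

  The hypothesis \<open>n \<ge> 4 / \<epsilon>\<close>, in the form \<open>2 \<le> sqrt n sqrt \<epsilon>\<close>, turns the factor \<open>1 / n\<close> of the tail
  into the \<open>1 / sqrt n\<close> of the bound (lemma \<open>sampling_constant_le\<close>).
\<close>

section \<open>The remainder of the cardinal series as a contour integral\<close>

lemma sin_pi_complex_zero_iff:
  "sin (complex_of_real pi * z) = 0 \<longleftrightarrow> z \<in> \<int>"
proof -
  have "sin (complex_of_real pi * z) = 0 \<longleftrightarrow> (\<exists>k::int. complex_of_real pi * z = complex_of_real (of_int k * pi))"
    by (simp add: sin_eq_0)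
  also have "\<dots> \<longleftrightarrow> (\<exists>k::int. z = of_int k)"
    by (auto simp: field_simps)
  finally show ?thesis by (auto simp: Ints_def)
qed

lemma sin_pi_real_nonzero:
  "t \<notin> \<int> \<Longrightarrow> sin (pi * t) \<noteq> 0"
  using sin_pi_complex_zero_iff[of "complex_of_real t"]
  by (metis Ints_cases Ints_of_int of_real_of_int_eq of_real_eq_iff of_real_mult of_real_0 sin_of_real)

lemma tendsto_divide_sin_pi:
  fixes k :: int
  shows "((\<lambda>w. (w - of_int k) / sin (complex_of_real pi * w)) \<longlongrightarrow> 1 / (pi * cos (pi * of_int k)))
          (at (of_int k :: complex))"
proof -
  have "((\<lambda>w. sin (complex_of_real pi * w)) has_field_derivative
          cos (complex_of_real pi * of_int k) * complex_of_real pi) (at (of_int k))"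
    by (auto intro!: derivative_eq_intros)
  then have "((\<lambda>w. (sin (complex_of_real pi * w) - sin (complex_of_real pi * of_int k)) / (w - of_int k))
               \<longlongrightarrow> cos (complex_of_real pi * of_int k) * pi) (at (of_int k))"
    by (simp add: has_field_derivative_iff)
  moreover have "sin (complex_of_real pi * of_int k) = 0"
    by (simp add: sin_pi_complex_zero_iff)
  moreover have "cos (complex_of_real pi * of_int k) * pi \<noteq> 0"
    using sin_cos_squared_add[of "complex_of_real pi * of_int k"] calculation(2)
    by (auto simp: power2_eq_square)
  ultimately have "((\<lambda>w. 1 / ((sin (complex_of_real pi * w) - 0) / (w - of_int k)))
               \<longlongrightarrow> 1 / (cos (complex_of_real pi * of_int k) * pi)) (at (of_int k))"
    by (intro tendsto_divide tendsto_const) auto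
  moreover have "cos (complex_of_real pi * of_int k) = complex_of_real (cos (pi * of_int k))"
    by (metis cos_of_real of_real_mult of_real_of_int_eq)
  ultimately show ?thesis by (simp add: mult.commute)
qed

text \<open>
  The integrand has simple poles at \<open>t\<close> and at the integers. The residue at \<open>t\<close> is
  \<open>f t / sin (\<pi> t)\<close>; the one at \<open>j\<close> is \<open>f j / ((j - t) \<pi> cos (\<pi> j))\<close>, and
  \<open>sin (\<pi> t) / cos (\<pi> j) = sin (\<pi> (t - j))\<close> turns it into the \<open>j\<close>-th term of the cardinal series.
  The integers inside the rectangle are those of \<open>J N\<close>.
\<close>

lemma sampling_remainder_contour:
  fixes f :: "complex \<Rightarrow> complex" and t Y :: real and N :: nat
  assumes f: "f holomorphic_on UNIV" and t: "t \<notin> \<int>" "1/2 - real N < t" "t < real N + 1/2"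
    and Y: "Y > 0"
  shows "sin (pi * t) * contour_integral (rectpath (Complex (1/2 - N) (-Y)) (Complex (N + 1/2) Y))
            (\<lambda>z. f z / ((z - t) * sin (pi * z)))
         = 2 * pi * \<i> * (f t - (\<Sum>j\<in>J N. f (of_int j) * (sin (pi * (t - of_int j)) / (pi * (t - of_int j)))))"
    (is "_ * contour_integral ?\<gamma> ?F = _")
proof -
  \<comment> \<open>The strip has to be narrow enough to contain no integer outside \<open>J N\<close>.\<close>
  define S where "S = {z. - real N < Re z} \<inter> {z. Re z < real N + 1}"
  define Q where "Q = (of_int ` J N :: complex set)"
  define p where "p = complex_of_real t"
  have S: "open S" "connected S"
    unfolding S_def by (auto intro!: open_Int open_halfspace_Re_lt open_halfspace_Re_gt
        convex_connected convex_Int convex_halfspace_Re_lt convex_halfspace_Re_gt)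
  have "N > 0"
    using t by (cases N) auto
  have zQ: "z \<in> Q" if "z \<in> S" "z \<in> \<int>" for z
    using that unfolding S_def Q_def J_def by (auto elim!: Ints_cases)
  have tZ: "p \<notin> \<int>"
    using t(1) unfolding p_def by (metis Ints_cases Ints_of_int of_real_eq_iff of_real_of_int_eq)
  then have pQ: "p \<notin> Q" 
    unfolding Q_def by auto
  have finQ: "finite Q" unfolding Q_def J_def by auto
  have inbox: "z \<in> box (Complex (1/2 - N) (-Y)) (Complex (N + 1/2) Y)" if "z \<in> insert p Q" for z
    using that t Y unfolding Q_def p_def J_def in_box_complex_iff by force
  have boxS: "cbox (Complex (1/2 - N) (-Y)) (Complex (N + 1/2) Y) \<subseteq> S"
    unfolding S_def in_cbox_complex_iff subset_iff by auto
  have holF: "?F holomorphic_on A" if "A \<subseteq> S - insert p Q" for A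
  proof -
    have "z - t \<noteq> 0" "sin (pi * z) \<noteq> 0" if "z \<in> A" for z :: complex
      using that \<open>A \<subseteq> _\<close> zQ[of z] by (auto simp: sin_pi_complex_zero_iff p_def)
    then show ?thesis
      by (intro holomorphic_intros holomorphic_on_subset[OF f]) auto
  qed
  have path: "path_image ?\<gamma> \<subseteq> S - insert p Q"
    using inbox boxS Y \<open>N > 0\<close> by (subst path_image_rectpath_cbox_minus_box) auto
  have "contour_integral ?\<gamma> ?F = 2 * pi * \<i> * (\<Sum>q\<in>insert p Q. winding_number ?\<gamma> q * residue ?F q)"
  proof (rule Residue_theorem[OF S])
    show "\<forall>z. z \<notin> S \<longrightarrow> winding_number ?\<gamma> z = 0"
      using boxS Y \<open>N > 0\<close> by (auto intro!: winding_number_rectpath_outside)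
  qed (use holF path finQ in auto)
  also have "(\<Sum>q\<in>insert p Q. winding_number ?\<gamma> q * residue ?F q) = residue ?F p + (\<Sum>q\<in>Q. residue ?F q)"
    using pQ finQ inbox by (simp add: winding_number_rectpath)
  also have "residue ?F p = f p / sin (pi * p)"
  proof (rule residue_simple')
    show "open (S - Q)" using S finQ by (simp add: finite_imp_closed open_Diff)
    show "p \<in> S - Q" using pQ t unfolding S_def p_def by auto
    show "?F holomorphic_on S - Q - {p}" by (rule holF) auto
    have "isCont (\<lambda>w. f w / sin (pi * w)) p"
      using tZ f by (auto intro!: continuous_intros simp: sin_pi_complex_zero_iff holomorphic_on_imp_continuous_on continuous_on_interior field_differentiable_imp_continuous_at holomorphic_on_imp_differentiable_at)
    then have "((\<lambda>w. f w / sin (pi * w)) \<longlongrightarrow> f p / sin (pi * p)) (at p)"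
      by (simp add: isCont_def)
    then show "((\<lambda>w. ?F w * (w - p)) \<longlongrightarrow> f p / sin (pi * p)) (at p)"
      by (rule Lim_transform_eventually)
         (auto simp: eventually_at_filter p_def intro!: always_eventually)
  qed
  also have "(\<Sum>q\<in>Q. residue ?F q) =
     (\<Sum>j\<in>J N. residue ?F (of_int j))"
    unfolding Q_def by (subst sum.reindex) (auto simp: inj_on_def)
  also have "\<dots> = (\<Sum>j\<in>J N. f (of_int j) / (of_int j - p) * (1 / (pi * cos (pi * of_int j))))"
  proof (rule sum.cong[OF refl], rule residue_simple')
    fix j assume j: "j \<in> J N"
    have jS: "of_int j \<in> S" "of_int j \<in> Q" using j inbox boxS unfolding Q_def S_def J_def by auto
    show "open (S - (insert p Q - {of_int j}))" using S finQ by (simp add: finite_imp_closed open_Diff)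
    show "of_int j \<in> S - (insert p Q - {of_int j})" using jS by auto
    show "?F holomorphic_on S - (insert p Q - {of_int j}) - {of_int j}" by (rule holF) auto
    have jp: "of_int j - p \<noteq> 0" using tZ by auto
    have "isCont (\<lambda>w. f w / (w - p)) (of_int j)"
      using jp f
      by (auto intro!: continuous_intros simp: field_differentiable_imp_continuous_at holomorphic_on_imp_differentiable_at)
    then have "((\<lambda>w. f w / (w - p)) \<longlongrightarrow> f (of_int j) / (of_int j - p)) (at (of_int j))"
      by (simp add: isCont_def)
    from tendsto_mult[OF this tendsto_divide_sin_pi[of j]]
    show "((\<lambda>w. ?F w * (w - of_int j)) \<longlongrightarrow> f (of_int j) / (of_int j - p) * (1 / (pi * cos (pi * of_int j)))) (at (of_int j))"
      by (simp add: p_def)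
  qed
  finally have eq: "contour_integral ?\<gamma> ?F = 2 * pi * \<i> * (f p / sin (pi * p) + 
     (\<Sum>j\<in>J N. f (of_int j) / (of_int j - p) * (1 / (pi * cos (pi * of_int j)))))" .
  have sp: "sin (pi * p) = complex_of_real (sin (pi * t))" 
    unfolding p_def by (metis of_real_mult sin_of_real)
  have nz: "sin (pi * t) \<noteq> 0" using t(1) by (rule sin_pi_real_nonzero)
  have summand: "sin (pi * t) * (f (of_int j) / (of_int j - p) * (1 / (pi * cos (pi * of_int j))))
     = - (f (of_int j) * (sin (pi * (t - of_int j)) / (pi * (t - of_int j))))" for j
  proof -
    define c where "c = cos (pi * of_int j)"
    have s0: "sin (pi * of_int j) = 0"
      by (metis mult.commute sin_zero_iff_int2)
    have c2: "c * c = 1"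
      using sin_cos_squared_add[of "pi * of_int j"] unfolding c_def s0 by (simp add: power2_eq_square)
    then have c0: "c \<noteq> 0" by auto
    have s: "sin (pi * (t - of_int j)) = sin (pi * t) * c"
      by (simp add: right_diff_distrib sin_diff s0 c_def)
    have "1 / (pi * c) = c / pi" using c0 by (simp add: divide_simps c2)
    then have "complex_of_real (1 / (pi * c)) = of_real (c / pi)" by simp
    then have e: "1 / (complex_of_real pi * of_real c) = of_real c / pi" by simp
    have "complex_of_real t \<noteq> of_int j" using tZ unfolding p_def by (metis Ints_of_int)
    then show ?thesis
      unfolding s c_def[symmetric] by (simp add: p_def e divide_simps) (simp add: algebra_simps)
  qed
  have "sin (pi * t) * (f p / of_real (sin (pi * t)) + (\<Sum>j\<in>J N. f (of_int j) / (of_int j - p) * (1 / (pi * cos (pi * of_int j)))))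
     = f p + (\<Sum>j\<in>J N. sin (pi * t) * (f (of_int j) / (of_int j - p) * (1 / (pi * cos (pi * of_int j)))))"
    using nz by (simp only: distrib_left sum_distrib_left) simp
  also have "\<dots> = f t - (\<Sum>j\<in>J N. f (of_int j) * (sin (pi * (t - of_int j)) / (pi * (t - of_int j))))"
    unfolding summand by (simp add: sum_negf p_def)
  finally show ?thesis
    unfolding eq sp by (metis (no_types, lifting) mult.left_commute)
qed

section \<open>Estimates on the sides of the rectangle\<close>

lemma gaussian_integral_le:
  fixes \<alpha> a b t :: real
  assumes "\<alpha> > 0"
  shows "integral {a..b} (\<lambda>x. exp (- \<alpha> * (x - t)\<^sup>2)) \<le> sqrt (pi / \<alpha>)"
proof -
  define \<sigma> where "\<sigma> = sqrt (1 / (2 * \<alpha>))"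
  have \<sigma>: "\<sigma> > 0" "\<sigma>\<^sup>2 = 1 / (2 * \<alpha>)" using assms by (auto simp: \<sigma>_def)
  have e: "exp (- \<alpha> * (x - t)\<^sup>2) = sqrt (pi / \<alpha>) * normal_density t \<sigma> x" for x
    using assms unfolding normal_density_def \<sigma>(2) by (simp add: real_sqrt_divide real_sqrt_mult)
  have int: "integrable lborel (\<lambda>x. exp (- \<alpha> * (x - t)\<^sup>2))"
    unfolding e using integrable_normal_moment[OF \<sigma>(1), of t 0] by simp
  have "set_integrable lborel {a..b} (\<lambda>x. exp (- \<alpha> * (x - t)\<^sup>2))"
    unfolding set_integrable_def by (rule integrable_mult_indicator[OF _ int]) auto
  then have "integral {a..b} (\<lambda>x. exp (- \<alpha> * (x - t)\<^sup>2)) = (LINT x:{a..b}|lborel. exp (- \<alpha> * (x - t)\<^sup>2))"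
    by (simp add: set_borel_integral_eq_integral)
  also have "\<dots> \<le> (LINT x|lborel. exp (- \<alpha> * (x - t)\<^sup>2))"
    unfolding set_lebesgue_integral_def
    using integrable_mult_indicator[OF _ int, of "{a..b}"]
    by (intro integral_mono int) (auto simp: indicator_def)
  also have "\<dots> = sqrt (pi / \<alpha>)"
    unfolding e using \<sigma>(1) integral_normal_moment_even[of \<sigma> t 0] by simp
  finally show ?thesis .
qed

text \<open>
  A bound by the maximum of the integrand would grow with the length of the side; the Gaussian
  factor gives one that is uniform in the width of the rectangle.
\<close>

lemma contour_integral_horizontal_gaussian_le:
  fixes f :: "complex \<Rightarrow> complex" and a b c \<alpha> t M :: real
  assumes "(f has_contour_integral I) (linepath (Complex a c) (Complex b c))"
    and "a < b" "\<alpha> > 0" "M \<ge> 0"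
    and M: "\<And>x. x \<in> {a..b} \<Longrightarrow> cmod (f (Complex x c)) \<le> M * exp (- \<alpha> * (x - t)\<^sup>2)"
  shows "cmod I \<le> M * sqrt (pi / \<alpha>)"
proof -
  have "((\<lambda>x. f (Complex x c)) has_integral I) {a..b}"
  proof -
    have "((\<lambda>z. f (z + \<i> * c)) has_contour_integral I) (linepath (of_real a) (of_real b))"
      using assms(1) unfolding has_contour_integral_linepath
      by (simp add: linepath_def Complex_eq algebra_simps scaleR_conv_of_real)
    then have "((\<lambda>x. f (of_real x + \<i> * c)) has_integral I) {a..b}"
      using \<open>a < b\<close> by (subst (asm) has_contour_integral_linepath_Reals_iff) auto
    then show ?thesis by (simp add: Complex_eq)
  qed
  moreover have "(\<lambda>x. M * exp (- \<alpha> * (x - t)\<^sup>2)) integrable_on {a..b}"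
    by (intro integrable_continuous_real continuous_intros)
  ultimately have "cmod I \<le> integral {a..b} (\<lambda>x. M * exp (- \<alpha> * (x - t)\<^sup>2))"
    using integral_norm_bound_integral[of "\<lambda>x. f (Complex x c)" "{a..b}" "\<lambda>x. M * exp (- \<alpha> * (x - t)\<^sup>2)"] M
    by (auto simp: has_integral_integrable_integral)
  also have "\<dots> = M * integral {a..b} (\<lambda>x. exp (- \<alpha> * (x - t)\<^sup>2))"
    by simp
  also have "\<dots> \<le> M * sqrt (pi / \<alpha>)"
    using gaussian_integral_le[OF \<open>\<alpha> > 0\<close>] \<open>M \<ge> 0\<close> by (intro mult_left_mono)
  finally show ?thesis .
qed

text \<open>
  From \<open>\<bar>sin z\<bar> \<ge> sinh \<bar>Im z\<bar>\<close>; the constant \<open>1 / 4\<close> in place of \<open>1 / 2\<close> absorbs the decaying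
  exponential of \<open>sinh\<close>.
\<close>

lemma norm_sin_horizontal_ge:
  fixes x y :: real
  assumes "\<bar>y\<bar> \<ge> 1"
  shows "cmod (sin (complex_of_real pi * Complex x y)) \<ge> exp (pi * \<bar>y\<bar>) / 4"
proof -
  define u where "u = exp (pi * \<bar>y\<bar>)"
  have "pi * \<bar>y\<bar> \<ge> 3 * 1"
    using assms pi_gt3 by (intro mult_mono) auto
  then have u: "u \<ge> 2" unfolding u_def using exp_ge_add_one_self[of "pi * \<bar>y\<bar>"] by linarith
  have "exp (2 * (pi * y)) + inverse (exp (2 * (pi * y))) = u\<^sup>2 + inverse (u\<^sup>2)"
    unfolding u_def by (cases "y \<ge> 0") (auto simp: exp_minus[symmetric] exp_double[symmetric])
  then have "cmod (sin (complex_of_real pi * Complex x y)) ^ 2 = (u\<^sup>2 + inverse (u\<^sup>2) - 2 * cos (2 * (pi * x))) / 4"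
    unfolding norm_sin_squared by simp
  also have "\<dots> \<ge> (u\<^sup>2 - 2) / 4"
    using cos_le_one[of "2 * (pi * x)"] by (intro divide_right_mono) (auto intro: add_increasing2 simp: algebra_simps)
  also have "(u\<^sup>2 - 2) / 4 \<ge> (u / 4)\<^sup>2"
    using power_mono[OF u, of 2] by (simp add: power_divide)
  finally show ?thesis unfolding u_def by (rule power2_le_imp_le) auto
qed

text \<open>
  On these vertical lines the modulus of the sine is exactly \<open>cosh (\<pi> y)\<close>.
\<close>

lemma norm_sin_half_integer_ge:
  fixes k :: int and y :: real
  shows "cmod (sin (complex_of_real pi * Complex (of_int k + 1/2) y)) \<ge> 1"
proof -
  define u where "u = exp (2 * (pi * y))"
  have "u > 0" by (simp add: u_def)
  have "2 * u \<le> u * u + 1" using zero_le_square[of "u - 1"] by (simp add: algebra_simps)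
  then have u: "2 \<le> u + inverse u" using \<open>u > 0\<close> by (simp add: field_simps)
  have "cos (2 * (pi * (of_int k + 1/2))) = cos (2 * pi * of_int k + pi)"
    by (simp add: algebra_simps)
  also have "\<dots> = -1" by (simp del: cos_periodic_pi add: cos_periodic_pi)
  finally have c: "cos (2 * (pi * (of_int k + 1/2))) = -1" .
  have "cmod (sin (complex_of_real pi * Complex (of_int k + 1/2) y)) ^ 2 
     = (u + inverse u - 2 * cos (2 * (pi * (of_int k + 1/2)))) / 4"
    unfolding norm_sin_squared by (simp add: u_def)
  also have "\<dots> \<ge> 1\<^sup>2" unfolding c using u by simp
  finally show ?thesis by (rule power2_le_imp_le) auto
qed

text \<open>
  The horizontal sides are treated with the Gaussian weight, the vertical ones by length times
  maximum, since the latter tend to zero when the rectangle is widened.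
\<close>

lemma norm_rectpath_integral_le:
  fixes f :: "complex \<Rightarrow> complex" and a b Y \<alpha> t M V :: real
  assumes cont: "continuous_on (path_image (rectpath (Complex a (-Y)) (Complex b Y))) f"
    and ab: "a < b" and Y: "Y > 0" and \<alpha>: "\<alpha> > 0" and M: "M \<ge> 0" and V: "V \<ge> 0"
    and hor: "\<And>x y. x \<in> {a..b} \<Longrightarrow> \<bar>y\<bar> = Y \<Longrightarrow> cmod (f (Complex x y)) \<le> M * exp (- \<alpha> * (x - t)\<^sup>2)"
    and ver: "\<And>x y. x = a \<or> x = b \<Longrightarrow> \<bar>y\<bar> \<le> Y \<Longrightarrow> cmod (f (Complex x y)) \<le> V"
  shows "cmod (contour_integral (rectpath (Complex a (-Y)) (Complex b Y)) f)
          \<le> 2 * (M * sqrt (pi / \<alpha>)) + 4 * Y * V"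
proof -
  let ?a1 = "Complex a (-Y)" and ?a2 = "Complex b (-Y)" and ?a3 = "Complex b Y" and ?a4 = "Complex a Y"
  have seg: "closed_segment u v \<subseteq> path_image (rectpath ?a1 ?a3)"
    if "(u, v) \<in> {(?a1, ?a2), (?a2, ?a3), (?a4, ?a3), (?a1, ?a4)}" for u v
    using that by (auto simp: rectpath_def Let_def path_image_join closed_segment_commute)
  have int: "(f has_contour_integral contour_integral (linepath u v) f) (linepath u v)"
    if "(u, v) \<in> {(?a1, ?a2), (?a2, ?a3), (?a4, ?a3), (?a1, ?a4)}" for u v
    by (intro has_contour_integral_integral contour_integrable_continuous_linepath
        continuous_on_subset[OF cont] seg that)
  have rev: "(f has_contour_integral - contour_integral (linepath u v) f) (linepath v u)"
    if "(u, v) \<in> {(?a1, ?a2), (?a2, ?a3), (?a4, ?a3), (?a1, ?a4)}" for u v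
    using int[OF that] by (rule has_contour_integral_reverse_linepath)
  have "(f has_contour_integral (contour_integral (linepath ?a1 ?a2) f + (contour_integral (linepath ?a2 ?a3) f
      + (- contour_integral (linepath ?a4 ?a3) f + - contour_integral (linepath ?a1 ?a4) f)))) (rectpath ?a1 ?a3)"
    unfolding rectpath_def Let_def complex.sel
    by (intro has_contour_integral_join int rev) auto
  then have eq: "contour_integral (rectpath ?a1 ?a3) f = contour_integral (linepath ?a1 ?a2) f + contour_integral (linepath ?a2 ?a3) f
      - contour_integral (linepath ?a4 ?a3) f - contour_integral (linepath ?a1 ?a4) f"
    by (simp add: contour_integral_unique)
  have h1: "cmod (contour_integral (linepath ?a1 ?a2) f) \<le> M * sqrt (pi / \<alpha>)"
    by (rule contour_integral_horizontal_gaussian_le[OF int ab \<alpha> M hor]) (use Y in auto)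
  have h2: "cmod (contour_integral (linepath ?a4 ?a3) f) \<le> M * sqrt (pi / \<alpha>)"
    by (rule contour_integral_horizontal_gaussian_le[OF int ab \<alpha> M hor]) (use Y in auto)
  have v: "cmod (contour_integral (linepath (Complex x (-Y)) (Complex x Y)) f) \<le> V * (2 * Y)" if "x = a \<or> x = b" for x
  proof -
    have "cmod (contour_integral (linepath (Complex x (-Y)) (Complex x Y)) f) \<le> V * cmod (Complex x Y - Complex x (-Y))"
    proof (rule has_contour_integral_bound_linepath[OF int V])
      show "(Complex x (-Y), Complex x Y) \<in> {(?a1, ?a2), (?a2, ?a3), (?a4, ?a3), (?a1, ?a4)}" using that by auto
      fix z assume "z \<in> closed_segment (Complex x (-Y)) (Complex x Y)"
      then have "Re z = x" "\<bar>Im z\<bar> \<le> Y"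
        using Y by (auto simp: closed_segment_same_Re closed_segment_eq_real_ivl)
      then show "cmod (f z) \<le> V"
        using ver[OF that, of "Im z"] by (metis complex.collapse)
    qed
    also have "Complex x Y - Complex x (-Y) = Complex 0 (2 * Y)" by (simp add: complex_eq_iff)
    also have "cmod \<dots> = 2 * Y" using Y by (simp add: cmod_eq_Im)
    finally show ?thesis .
  qed
  have tri: "cmod (A + B - C - D) \<le> cmod A + cmod B + cmod C + cmod D" for A B C D
    by (meson add_mono norm_triangle_ineq norm_triangle_ineq4 order_refl order_trans)
  show ?thesis
    unfolding eq using h1 h2 v[of a] v[of b] by (intro order_trans[OF tri]) (auto simp: algebra_simps)
qed

lemma norm_exp_gaussian:
  fixes x y t \<xi> \<alpha> :: real
  shows "cmod (exp (\<i> * \<xi> * Complex x y - \<alpha> * (Complex x y - t)\<^sup>2))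
    = exp (- \<xi> * y + \<alpha> * y\<^sup>2) * exp (- \<alpha> * (x - t)\<^sup>2)"
  by (simp add: norm_exp_eq_Re exp_add[symmetric] power2_eq_square algebra_simps)

section \<open>Gaussian-regularised sampling of pure frequencies\<close>

definition gauss_sinc :: "real \<Rightarrow> real \<Rightarrow> real" where
  "gauss_sinc \<alpha> x = sinc (pi * x) * exp (- \<alpha> * x\<^sup>2)"

lemma gauss_sinc_int: "gauss_sinc \<alpha> (of_int k) = (if k = 0 then 1 else 0)"
proof -
  have "sin (pi * real_of_int k) = 0" by (metis mult.commute sin_zero_iff_int2)
  then show ?thesis by (auto simp: gauss_sinc_def)
qed

text \<open>
  The contour representation for the entire function
  \<open>z \<mapsto> exp (\<i> \<xi> z - \<alpha> (z - t)\<^sup>2)\<close>, whose value at \<open>t\<close> is \<open>exp (\<i> \<xi> t)\<close>, on a rectangle of height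
  \<open>2 n\<close>. The first summand comes from the horizontal sides, where \<open>\<alpha>\<close> is such that
  \<open>\<delta> n + \<alpha> n\<^sup>2 - \<pi> n = - (\<pi> - \<delta>) n / 2\<close>; the second one comes from the vertical sides and vanishes as
  \<open>N\<close> grows.
\<close>

lemma exp_gauss_sinc_remainder:
  fixes \<delta> \<xi> t \<alpha> :: real and n N :: nat
  assumes \<delta>: "\<delta> < pi" and \<xi>: "\<bar>\<xi>\<bar> \<le> \<delta>" and t: "0 < t" "t < 1" and n: "n \<ge> 1" and N: "N \<ge> 1"
    and \<alpha>_def: "\<alpha> = (pi - \<delta>) / (2 * real n)"
  shows "cmod (exp (\<i> * \<xi> * t) - (\<Sum>j\<in>J N. gauss_sinc \<alpha> (t - j) * exp (\<i> * \<xi> * of_int j)))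
    \<le> 4 * exp (- ((pi - \<delta>) / 2 * n)) / (pi * n) * sqrt (pi / \<alpha>)
      + 4 * real n * exp (\<delta> * n + \<alpha> * n\<^sup>2) / pi * exp (- \<alpha> * (real N - 1/2)\<^sup>2)"
proof -
  define f where "f = (\<lambda>z::complex. exp (\<i> * \<xi> * z - \<alpha> * (z - t)\<^sup>2))"
  define F where "F = (\<lambda>z::complex. f z / ((z - t) * sin (pi * z)))"
  define a b where "a = 1/2 - real N" and "b = real N + 1/2"
  \<comment> \<open>On the horizontal sides \<open>\<bar>z - t\<bar> \<ge> n\<close> and \<open>\<bar>sin (\<pi> z)\<bar> \<ge> exp (\<pi> n) / 4\<close>; on the vertical ones
    \<open>\<bar>z - t\<bar> \<ge> 1 / 2\<close> and \<open>\<bar>sin (\<pi> z)\<bar> \<ge> 1\<close>.\<close>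
  define M V where "M = 4 * exp (- ((pi - \<delta>) / 2 * n)) / n"
    and "V = 2 * exp (\<delta> * n + \<alpha> * n\<^sup>2) * exp (- \<alpha> * (real N - 1/2)\<^sup>2)"
  have \<alpha>: "\<alpha> > 0" using \<delta> n by (simp add: \<alpha>_def)
  have tZ: "t \<notin> \<int>" using t by (auto elim!: Ints_cases)
  have ab: "a < b" "a \<le> -1/2" "b \<ge> 3/2" using N by (auto simp: a_def b_def)
  have nf: "cmod (f (Complex x y)) \<le> exp (\<delta> * \<bar>y\<bar> + \<alpha> * y\<^sup>2) * exp (- \<alpha> * (x - t)\<^sup>2)" for x y
  proof -
    have "- \<xi> * y \<le> \<bar>\<xi>\<bar> * \<bar>y\<bar>" by (metis abs_ge_minus_self abs_mult mult_minus_left)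
    also have "\<dots> \<le> \<delta> * \<bar>y\<bar>" using \<xi> by (intro mult_right_mono) auto
    finally show ?thesis unfolding f_def norm_exp_gaussian by simp
  qed
  have sin1: "cmod (sin (complex_of_real pi * Complex x y)) \<ge> 1" if "x = a \<or> x = b" for x y
  proof -
    have "a = of_int (- int N) + 1/2" "b = of_int (int N) + 1/2" by (auto simp: a_def b_def)
    then show ?thesis using that norm_sin_half_integer_ge by metis
  qed
  have e: "\<delta> * n + \<alpha> * n\<^sup>2 - pi * n = - ((pi - \<delta>) / 2 * n)"
    using n by (simp add: \<alpha>_def power2_eq_square field_simps)
  have hor: "cmod (F (Complex x y)) \<le> M * exp (- \<alpha> * (x - t)\<^sup>2)" if y: "\<bar>y\<bar> = real n" for x y
  proof -
    have "real n = \<bar>Im (Complex x y - t)\<bar>" using y by simp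
    also have "\<dots> \<le> cmod (Complex x y - t)" by (rule abs_Im_le_cmod)
    finally have d: "real n \<le> cmod (Complex x y - t)" .
    have s: "exp (pi * n) / 4 \<le> cmod (sin (complex_of_real pi * Complex x y))"
      using norm_sin_horizontal_ge[of y x] y n by simp
    have y2: "y\<^sup>2 = (real n)\<^sup>2" using y by (metis power2_abs)
    have "cmod (F (Complex x y)) \<le> exp (\<delta> * n + \<alpha> * n\<^sup>2) * exp (- \<alpha> * (x - t)\<^sup>2) / (n * (exp (pi * n) / 4))"
      unfolding F_def norm_divide norm_mult
      using nf[of x y] n y d s unfolding y y2 by (intro frac_le mult_mono) auto
    also have "\<dots> = M * exp (- \<alpha> * (x - t)\<^sup>2)"
      unfolding M_def e[symmetric] exp_diff by (simp add: field_simps)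
    finally show ?thesis .
  qed
  have ver: "cmod (F (Complex x y)) \<le> V" if x: "x = a \<or> x = b" and y: "\<bar>y\<bar> \<le> real n" for x y
  proof -
    have xt: "real N - 1/2 \<le> \<bar>x - t\<bar>" using x t N by (auto simp: a_def b_def)
    have "1 / 2 \<le> \<bar>Re (Complex x y - t)\<bar>" using xt N by simp
    also have "\<dots> \<le> cmod (Complex x y - t)" by (rule abs_Re_le_cmod)
    finally have d: "1/2 \<le> cmod (Complex x y - t)" .
    have "(real N - 1/2)\<^sup>2 \<le> (x - t)\<^sup>2" using power_mono[OF xt, of 2] N by simp
    then have g: "exp (- \<alpha> * (x - t)\<^sup>2) \<le> exp (- \<alpha> * (real N - 1/2)\<^sup>2)" using \<alpha> by simp
    have "\<bar>y\<bar>\<^sup>2 \<le> (real n)\<^sup>2" using y by (intro power_mono) auto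
    then have "\<delta> * \<bar>y\<bar> + \<alpha> * y\<^sup>2 \<le> \<delta> * n + \<alpha> * n\<^sup>2" using y \<alpha> \<xi> by (intro add_mono mult_left_mono) auto
    then have "cmod (f (Complex x y)) \<le> exp (\<delta> * n + \<alpha> * n\<^sup>2) * exp (- \<alpha> * (real N - 1/2)\<^sup>2)"
      using g by (intro order_trans[OF nf] mult_mono) auto
    then have "cmod (F (Complex x y)) \<le> exp (\<delta> * n + \<alpha> * n\<^sup>2) * exp (- \<alpha> * (real N - 1/2)\<^sup>2) / (1/2 * 1)"
      unfolding F_def norm_divide norm_mult using d sin1[OF x] by (intro frac_le mult_mono) auto
    then show ?thesis by (simp add: V_def)
  qed
  have nz: "(z - t) * sin (pi * z) \<noteq> 0" if z: "z \<in> path_image (rectpath (Complex a (- real n)) (Complex b (real n)))" for z :: complex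
  proof -
    consider "Re z = a \<or> Re z = b" | "\<bar>Im z\<bar> = real n"
      using z ab by (auto simp: path_image_rectpath)
    then show ?thesis
    proof cases
      case 1
      then have "z \<noteq> t" using ab t by auto
      moreover have "sin (pi * z) \<noteq> 0" using sin1[OF 1, of "Im z"] by auto
      ultimately show ?thesis by simp
    next
      case 2
      have "exp (pi * \<bar>Im z\<bar>) / 4 \<le> cmod (sin (pi * z))"
        using norm_sin_horizontal_ge[of "Im z" "Re z"] 2 n by simp
      then have "sin (pi * z) \<noteq> 0"
        using exp_gt_zero[of "pi * \<bar>Im z\<bar>"] by (auto simp del: exp_gt_zero)
      moreover have "z \<noteq> t" using 2 n by auto
      ultimately show ?thesis by simp
    qed
  qed
  have "continuous_on (path_image (rectpath (Complex a (- real n)) (Complex b (real n)))) F"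
    unfolding F_def f_def using nz by (intro continuous_intros) auto
  then have main: "cmod (contour_integral (rectpath (Complex a (- real n)) (Complex b (real n))) F)
      \<le> 2 * (M * sqrt (pi / \<alpha>)) + 4 * real n * V"
    by (rule norm_rectpath_integral_le) (use ab n \<alpha> hor ver in \<open>auto simp: M_def V_def\<close>)
  define E where "E = exp (\<i> * \<xi> * t) - (\<Sum>j\<in>J N. gauss_sinc \<alpha> (t - j) * exp (\<i> * \<xi> * of_int j))"
  have "f t - (\<Sum>j\<in>J N. f (of_int j) * (sin (pi * (t - of_int j)) / (pi * (t - of_int j)))) = E"
  proof -
    have "f (of_int j) * (sin (pi * (t - of_int j)) / (pi * (t - of_int j))) = gauss_sinc \<alpha> (t - j) * exp (\<i> * \<xi> * of_int j)" for j
    proof -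
      have "t \<noteq> of_int j" using tZ by auto
      moreover have "f (of_int j) = exp (\<i> * \<xi> * of_int j) * complex_of_real (exp (- \<alpha> * (t - j)\<^sup>2))"
        unfolding f_def exp_diff exp_of_real[symmetric] by (simp add: exp_minus power2_commute divide_inverse)
      ultimately show ?thesis by (simp add: gauss_sinc_def)
    qed
    then show ?thesis by (simp add: E_def f_def)
  qed
  moreover have "f holomorphic_on UNIV" unfolding f_def by (intro holomorphic_intros)
  ultimately have "sin (pi * t) * contour_integral (rectpath (Complex a (- real n)) (Complex b (real n))) F = 2 * pi * \<i> * E"
    using sampling_remainder_contour[of f t N "real n"] tZ t N n unfolding F_def a_def b_def by simp
  then have "cmod (2 * pi * \<i> * E) = \<bar>sin (pi * t)\<bar> * cmod (contour_integral (rectpath (Complex a (- real n)) (Complex b (real n))) F)"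
    by (metis norm_mult norm_of_real)
  also have "\<dots> \<le> 1 * (2 * (M * sqrt (pi / \<alpha>)) + 4 * real n * V)"
    using main by (intro mult_mono) auto
  finally have "2 * pi * cmod E \<le> 2 * (M * sqrt (pi / \<alpha>)) + 4 * real n * V"
    by (simp add: norm_mult)
  then have "cmod E \<le> (M * sqrt (pi / \<alpha>) + 2 * real n * V) / pi"
    by (simp add: field_simps)
  also have "\<dots> = 4 * exp (- ((pi - \<delta>) / 2 * n)) / (pi * n) * sqrt (pi / \<alpha>)
      + 4 * real n * exp (\<delta> * n + \<alpha> * n\<^sup>2) / pi * exp (- \<alpha> * (real N - 1/2)\<^sup>2)"
    unfolding M_def V_def by (simp add: add_divide_distrib mult_ac)
  finally show ?thesis unfolding E_def .
qed

text \<open>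
  The Gaussian exponent is \<open>\<alpha> x\<^sup>2 \<ge> \<alpha> (n\<^sup>2 + 2 n m) = \<epsilon> n / 2 + \<epsilon> m\<close>: beyond distance \<open>n\<close> the decay is
  at least geometric with ratio \<open>exp (- \<epsilon>)\<close>.
\<close>

lemma abs_gauss_sinc_le:
  fixes \<epsilon> \<alpha> m x :: real and n :: nat
  assumes "\<epsilon> > 0" "n \<ge> 1" and \<alpha>_def: "\<alpha> = \<epsilon> / (2 * real n)" and m: "m \<ge> 0" "real n + m \<le> \<bar>x\<bar>"
  shows "\<bar>gauss_sinc \<alpha> x\<bar> \<le> exp (- (\<epsilon> / 2 * n)) / (pi * n) * exp (- \<epsilon> * m)"
proof -
  have x: "x \<noteq> 0" "real n \<le> \<bar>x\<bar>" using assms by auto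
  have \<alpha>: "\<alpha> > 0" using assms by simp
  have 1: "\<bar>sin (pi * x)\<bar> / (pi * \<bar>x\<bar>) \<le> 1 / (pi * n)"
    using x \<open>n \<ge> 1\<close> by (intro frac_le mult_left_mono) auto
  have "(real n)\<^sup>2 + 2 * n * m \<le> (real n + m)\<^sup>2" by (simp add: power2_sum)
  also have "\<dots> \<le> x\<^sup>2" using power_mono[OF m(2), of 2] m(1) by simp
  finally have "\<alpha> * ((real n)\<^sup>2 + 2 * n * m) \<le> \<alpha> * x\<^sup>2" using \<alpha> by simp
  moreover have "\<alpha> * ((real n)\<^sup>2 + 2 * n * m) = \<epsilon> / 2 * n + \<epsilon> * m"
    using \<open>n \<ge> 1\<close> unfolding \<alpha>_def by (simp add: field_simps power2_eq_square)
  ultimately have 2: "exp (- \<alpha> * x\<^sup>2) \<le> exp (- (\<epsilon> / 2 * n)) * exp (- \<epsilon> * m)"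
    unfolding exp_add[symmetric] by simp
  have "\<bar>gauss_sinc \<alpha> x\<bar> = \<bar>sin (pi * x)\<bar> / (pi * \<bar>x\<bar>) * exp (- \<alpha> * x\<^sup>2)"
    using x by (simp add: gauss_sinc_def abs_mult)
  also have "\<dots> \<le> 1 / (pi * n) * (exp (- (\<epsilon> / 2 * n)) * exp (- \<epsilon> * m))"
    using 1 2 by (intro mult_mono) auto
  finally show ?thesis by simp
qed

lemma sum_exp_neg_le:
  fixes \<epsilon> :: real
  assumes "\<epsilon> > 0"
  shows "(\<Sum>m<k. exp (- \<epsilon> * real m)) \<le> 1 + 1 / \<epsilon>"
proof -
  define q where "q = exp (- \<epsilon>)"
  have q: "q > 0" "q < 1" using assms by (auto simp: q_def)
  have "(1 + \<epsilon>) * q \<le> exp \<epsilon> * q" using q by (intro mult_right_mono) auto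
  also have "\<dots> = 1" by (simp add: q_def exp_minus)
  finally have q1: "(1 + \<epsilon>) * q \<le> 1" .
  have "(\<Sum>m<k. exp (- \<epsilon> * real m)) = (\<Sum>m<k. q ^ m)"
    by (simp add: q_def exp_of_nat_mult[symmetric] mult.commute)
  also have "\<dots> = (1 - q ^ k) / (1 - q)"
    using q by (simp add: sum_gp_strict)
  also have "\<dots> \<le> 1 / (1 - q)" using q by (intro divide_right_mono) auto
  also have "\<dots> \<le> 1 + 1 / \<epsilon>" using q q1 assms by (simp add: field_simps)
  finally show ?thesis .
qed

text \<open>
  The indices outside \<open>J n\<close> are \<open>n + 1 + m\<close> and \<open>- n - m\<close> with \<open>m \<ge> 0\<close>, all of them at distance at
  least \<open>n + m\<close> from \<open>[0, 1]\<close>. This is where the asymmetry of \<open>J n\<close> fits the interval. Each of the two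
  families is dominated by a geometric series, uniformly in \<open>N\<close>.
\<close>

lemma gauss_sinc_tail:
  fixes \<epsilon> \<alpha> t :: real and n N :: nat
  assumes \<epsilon>: "\<epsilon> > 0" and n: "n \<ge> 1" and \<alpha>: "\<alpha> = \<epsilon> / (2 * real n)" and t: "0 \<le> t" "t \<le> 1"
  shows "(\<Sum>j\<in>J N - J n. \<bar>gauss_sinc \<alpha> (t - of_int j)\<bar>)
    \<le> 2 * (1 + 1 / \<epsilon>) / (pi * n) * exp (- (\<epsilon> / 2 * n))"
proof -
  define C where "C = exp (- (\<epsilon> / 2 * n)) / (pi * n)"
  define u v where "u = (\<lambda>m::nat. int n + 1 + int m)" and "v = (\<lambda>m::nat. - int n - int m)"
  have C: "C \<ge> 0" by (simp add: C_def)
  have inj: "inj u" "inj v" by (auto simp: inj_def u_def v_def)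
  have "J N - J n \<subseteq> u ` {..<N} \<union> v ` {..<N}"
  proof
    fix j assume "j \<in> J N - J n"
    then have "j = u (nat (j - int n - 1)) \<and> nat (j - int n - 1) < N \<or> j = v (nat (- j - int n)) \<and> nat (- j - int n) < N"
      using n unfolding J_def u_def v_def by auto
    then show "j \<in> u ` {..<N} \<union> v ` {..<N}" by blast
  qed
  then have "(\<Sum>j\<in>J N - J n. \<bar>gauss_sinc \<alpha> (t - of_int j)\<bar>)
      \<le> (\<Sum>j\<in>u ` {..<N} \<union> v ` {..<N}. \<bar>gauss_sinc \<alpha> (t - of_int j)\<bar>)"
    by (intro sum_mono2) auto
  also have "\<dots> = (\<Sum>j\<in>u ` {..<N}. \<bar>gauss_sinc \<alpha> (t - of_int j)\<bar>) + (\<Sum>j\<in>v ` {..<N}. \<bar>gauss_sinc \<alpha> (t - of_int j)\<bar>)"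
    by (intro sum.union_disjoint) (auto simp: u_def v_def)
  also have "\<dots> = (\<Sum>m<N. \<bar>gauss_sinc \<alpha> (t - of_int (u m))\<bar>) + (\<Sum>m<N. \<bar>gauss_sinc \<alpha> (t - of_int (v m))\<bar>)"
    by (subst (1 2) sum.reindex) (auto intro: inj_on_subset[OF inj(1)] inj_on_subset[OF inj(2)])
  also have "\<dots> \<le> (\<Sum>m<N. C * exp (- \<epsilon> * real m)) + (\<Sum>m<N. C * exp (- \<epsilon> * real m))"
    unfolding C_def
    by (intro add_mono sum_mono abs_gauss_sinc_le[OF \<epsilon> n \<alpha>]) (use t in \<open>auto simp: u_def v_def\<close>)
  also have "\<dots> = 2 * (C * (\<Sum>m<N. exp (- \<epsilon> * real m)))"
    by (simp add: sum_distrib_left)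
  also have "\<dots> \<le> 2 * (C * (1 + 1 / \<epsilon>))"
    using sum_exp_neg_le[OF \<epsilon>, of N] C by (intro mult_left_mono) auto
  also have "\<dots> = 2 * (1 + 1 / \<epsilon>) / (pi * n) * exp (- (\<epsilon> / 2 * n))"
    unfolding C_def by (simp only: times_divide_eq_left times_divide_eq_right mult_ac)
  finally show ?thesis .
qed

text \<open>
  For \<open>t\<close> strictly between \<open>0\<close> and \<open>1\<close>, combine the remainder of the series over \<open>J N\<close> with the tail
  and let \<open>N\<close> tend to infinity. At the two endpoints, which are sampling points in \<open>J n\<close>, the series
  interpolates and the error is zero.
\<close>

lemma exp_gauss_sinc_error:
  fixes \<delta> \<xi> t \<alpha> :: real and n :: nat
  assumes \<delta>: "\<delta> < pi" and \<xi>: "\<bar>\<xi>\<bar> \<le> \<delta>" and t: "0 \<le> t" "t \<le> 1" and n: "n \<ge> 1"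
    and \<alpha>: "\<alpha> = (pi - \<delta>) / (2 * real n)"
  shows "cmod (exp (\<i> * \<xi> * t) - (\<Sum>j\<in>J n. gauss_sinc \<alpha> (t - j) * exp (\<i> * \<xi> * of_int j)))
    \<le> (4 * sqrt (pi / \<alpha>) + 2 * (1 + 1 / (pi - \<delta>))) / (pi * n) * exp (- ((pi - \<delta>) / 2 * n))"
proof (cases "t \<in> {0, 1}")
  case True
  then obtain k :: int where k: "t = of_int k" "k \<in> {0, 1}" by (metis insert_iff of_int_0 of_int_1 singletonD)
  have "(\<Sum>j\<in>J n. gauss_sinc \<alpha> (t - j) * exp (\<i> * \<xi> * of_int j)) = (\<Sum>j\<in>J n. if j = k then exp (\<i> * \<xi> * of_int j) else 0)"
    unfolding k(1) of_int_diff[symmetric] gauss_sinc_int by (intro sum.cong) auto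
  also have "\<dots> = exp (\<i> * \<xi> * t)"
    using k n by (subst sum.delta) (auto simp: J_def)
  finally have "cmod (exp (\<i> * \<xi> * t) - (\<Sum>j\<in>J n. gauss_sinc \<alpha> (t - j) * exp (\<i> * \<xi> * of_int j))) = 0" by simp
  then show ?thesis using \<delta> unfolding \<alpha> by simp
next
  case False
  then have t': "0 < t" "t < 1" using t by auto
  define h where "h = (\<lambda>j::int. gauss_sinc \<alpha> (t - j) * exp (\<i> * \<xi> * of_int j))"
  define T where "T = 2 * (1 + 1 / (pi - \<delta>)) / (pi * n) * exp (- ((pi - \<delta>) / 2 * n))"
  define C where "C = 4 * real n * exp (\<delta> * n + \<alpha> * n\<^sup>2) / pi"
  define R where "R = 4 * exp (- ((pi - \<delta>) / 2 * n)) / (pi * n) * sqrt (pi / \<alpha>)"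
  have \<alpha>0: "\<alpha> > 0" using \<delta> n by (simp add: \<alpha>)
  have le: "cmod (exp (\<i> * \<xi> * t) - sum h (J n)) \<le> R + C * exp (- \<alpha> * (real N - 1/2)\<^sup>2) + T" if "N \<ge> n" for N
  proof -
    have "J n \<subseteq> J N" using that by (auto simp: J_def)
    then have "sum h (J N) = sum h (J N - J n) + sum h (J n)"
      by (intro sum.subset_diff) (auto simp: J_def)
    then have "exp (\<i> * \<xi> * t) - sum h (J n) = (exp (\<i> * \<xi> * t) - sum h (J N)) + sum h (J N - J n)" by simp
    then have "cmod (exp (\<i> * \<xi> * t) - sum h (J n)) \<le> cmod (exp (\<i> * \<xi> * t) - sum h (J N)) + cmod (sum h (J N - J n))"
      by (metis norm_triangle_ineq)
    moreover have "cmod (exp (\<i> * \<xi> * t) - sum h (J N)) \<le> R + C * exp (- \<alpha> * (real N - 1/2)\<^sup>2)"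
      unfolding h_def R_def C_def using that n
      by (intro exp_gauss_sinc_remainder[OF \<delta> \<xi> t' n _ \<alpha>]) auto
    moreover have "cmod (sum h (J N - J n)) \<le> (\<Sum>j\<in>J N - J n. \<bar>gauss_sinc \<alpha> (t - of_int j)\<bar>)"
      by (intro sum_norm_le) (simp add: h_def norm_mult)
    moreover have "\<dots> \<le> T"
      unfolding T_def using \<delta> by (intro gauss_sinc_tail[OF _ n \<alpha> t]) auto
    ultimately show ?thesis by linarith
  qed
  have "(\<lambda>N. R + C * exp (- \<alpha> * (real N - 1/2)\<^sup>2) + T) \<longlonglongrightarrow> R + C * 0 + T"
  proof (intro tendsto_intros)
    show "(\<lambda>N. exp (- \<alpha> * (real N - 1/2)\<^sup>2)) \<longlonglongrightarrow> 0"
      using \<alpha>0 by real_asymp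
  qed
  then have "cmod (exp (\<i> * \<xi> * t) - sum h (J n)) \<le> R + C * 0 + T"
    by (rule LIMSEQ_le_const) (use le in blast)
  also have "\<dots> = (4 * sqrt (pi / \<alpha>) + 2 * (1 + 1 / (pi - \<delta>))) / (pi * n) * exp (- ((pi - \<delta>) / 2 * n))"
  proof -
    have "4 * E / d * S + W / d * E = (4 * S + W) / d * E" for E d S W :: real
      by (simp add: add_divide_distrib algebra_simps)
    then show ?thesis unfolding R_def T_def by simp
  qed
  finally show ?thesis unfolding h_def .
qed

text \<open>
  The two summands of the bracket on the right absorb different parts of the left-hand side. With
  \<open>sqrt n sqrt \<epsilon> \<ge> 2\<close>, the term \<open>sqrt \<epsilon> / 2\<close> pays for the constant \<open>2\<close>, and \<open>2 sqrt 2 / sqrt \<epsilon>\<close> pays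
  for both the Gaussian integral and \<open>2 / \<epsilon>\<close>; \<open>exp 1 \<ge> 5 / 2\<close> suffices.
\<close>

lemma sampling_constant_le:
  fixes \<epsilon> \<alpha> :: real and n :: nat
  assumes \<epsilon>: "\<epsilon> > 0" and n: "real n \<ge> 4 / \<epsilon>" and \<alpha>: "\<alpha> = \<epsilon> / (2 * real n)"
  shows "(4 * sqrt (pi / \<alpha>) + 2 * (1 + 1 / \<epsilon>)) / (pi * n)
    \<le> 11 * exp 1 / (10 * sqrt pi) * (sqrt \<epsilon> / 2 + 2 * sqrt 2 / sqrt \<epsilon>) * (1 / sqrt n)"
proof -
  define s r p e w where "s = sqrt \<epsilon>" and "r = sqrt n" and "p = sqrt pi" and "e = 11 * exp (1::real) / 10"
    and "w = sqrt (2::real)"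
  have "4 / \<epsilon> > 0" using \<epsilon> by simp
  then have "real n > 0" using n by linarith
  then have pos: "s > 0" "r > 0" "p > 0" "w > 0" using \<epsilon> by (auto simp: s_def r_def p_def w_def)
  have sq: "\<epsilon> = s * s" "real n = r * r" "pi = p * p" using \<epsilon> by (auto simp: s_def r_def p_def)
  have "p \<ge> 1" "w \<ge> 1" unfolding p_def w_def using pi_gt3 by auto
  have "(5/2::real) \<le> exp 1" using exp_lower_Taylor_quadratic[of "1::real"] by simp
  then have e: "e \<ge> 11/4" by (simp add: e_def)
  have "2\<^sup>2 \<le> real n * \<epsilon>" using n \<epsilon> by (simp add: field_simps)
  also have "\<dots> = (r * s)\<^sup>2" by (simp add: sq power2_eq_square)
  finally have rs: "2 \<le> r * s" by (rule power2_le_imp_le) (use pos in auto)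
  have \<alpha>': "sqrt (pi / \<alpha>) = p * w * r / s"
    unfolding \<alpha> p_def w_def r_def s_def by (simp add: real_sqrt_divide real_sqrt_mult)
  have "4 * (p * w * r / s) + 2 * (1 + 1 / \<epsilon>) \<le> e * p * r * (s / 2 + 2 * w / s)"
  proof -
    have 1: "2 \<le> e * p * r * (s / 2)"
    proof -
      have "1 \<le> p * (e / 2)" using mult_mono[OF \<open>1 \<le> p\<close>, of 1 "e / 2"] e \<open>1 \<le> p\<close> by simp
      then have "2 * 1 \<le> (r * s) * (p * (e / 2))" using rs pos by (intro mult_mono) auto
      then show ?thesis by (simp add: mult_ac)
    qed
    have "2 / (s * s) \<le> r * s / (s * s)" using rs by (intro divide_right_mono) auto
    then have "2 * (1 / \<epsilon>) \<le> r / s" using pos by (simp add: sq(1))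
    moreover have "4 * (p * w * r / s) + r / s \<le> e * p * r * (2 * w / s)"
    proof -
      have "1 * 1 \<le> p * w" using \<open>p \<ge> 1\<close> \<open>w \<ge> 1\<close> by (intro mult_mono) auto
      then have "1 \<le> p * w * (2 * e - 4)" using mult_mono[of 1 "p * w" 1 "2 * e - 4"] e by simp
      then have "r / s * 1 \<le> r / s * (p * w * (2 * e - 4))" using pos by (intro mult_left_mono) auto
      then show ?thesis by (simp add: algebra_simps)
    qed
    ultimately show ?thesis using 1 by (simp add: distrib_left)
  qed
  then have "(4 * sqrt (pi / \<alpha>) + 2 * (1 + 1 / \<epsilon>)) / (pi * n) \<le> e * p * r * (s / 2 + 2 * w / s) / (pi * n)"
    unfolding \<alpha>' using pos sq by (intro divide_right_mono) auto
  also have "\<dots> = 11 * exp 1 / (10 * p) * (s / 2 + 2 * w / s) * (1 / r)"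
    unfolding sq(2,3) e_def using pos by (simp add: field_simps)
  finally show ?thesis unfolding p_def s_def w_def r_def .
qed

section \<open>Functionals on a reproducing kernel Hilbert space\<close>

lemma hilbert_function_space_rules:
  assumes "hilbert_function_space H ip"
  shows "(\<lambda>x. 0) \<in> H"
    and "f \<in> H \<Longrightarrow> g \<in> H \<Longrightarrow> (\<lambda>x. f x + g x) \<in> H"
    and "f \<in> H \<Longrightarrow> (\<lambda>x. a * f x) \<in> H"
    and "f \<in> H \<Longrightarrow> g \<in> H \<Longrightarrow> h \<in> H \<Longrightarrow> ip (\<lambda>x. f x + g x) h = ip f h + ip g h"
    and "f \<in> H \<Longrightarrow> g \<in> H \<Longrightarrow> ip (\<lambda>x. a * f x) g = a * ip f g"
    and "f \<in> H \<Longrightarrow> g \<in> H \<Longrightarrow> ip g f = cnj (ip f g)"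
    and "f \<in> H \<Longrightarrow> f \<noteq> (\<lambda>x. 0) \<Longrightarrow> 0 < Re (ip f f)"
  using assms unfolding hilbert_function_space_def by blast+

lemma hilbert_function_space_ip_zero:
  assumes "hilbert_function_space H ip" and "g \<in> H"
  shows "ip (\<lambda>x. 0) g = 0"
  using hilbert_function_space_rules(5)[OF assms(1) hilbert_function_space_rules(1)[OF assms(1)] assms(2), of 0]
  by simp

lemma hilbert_function_space_ip_nonneg:
  assumes "hilbert_function_space H ip" and "f \<in> H"
  shows "0 \<le> Re (ip f f)"
  using hilbert_function_space_rules(7)[OF assms] hilbert_function_space_ip_zero[OF assms]
  by (cases "f = (\<lambda>x. 0)") auto

lemma hilbert_function_space_sum:
  assumes H: "hilbert_function_space H ip" and "finite I" and h: "\<And>i. i \<in> I \<Longrightarrow> h i \<in> H"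
  shows "(\<lambda>x. \<Sum>i\<in>I. a i * h i x) \<in> H"
    and "g \<in> H \<Longrightarrow> ip (\<lambda>x. \<Sum>i\<in>I. a i * h i x) g = (\<Sum>i\<in>I. a i * ip (h i) g)"
proof -
  note ax = hilbert_function_space_rules[OF H]
  have "(\<lambda>x. \<Sum>i\<in>I. a i * h i x) \<in> H \<and>
     (g \<in> H \<longrightarrow> ip (\<lambda>x. \<Sum>i\<in>I. a i * h i x) g = (\<Sum>i\<in>I. a i * ip (h i) g))"
    using \<open>finite I\<close> h
  proof (induction I)
    case empty
    then show ?case using ax(1) hilbert_function_space_ip_zero[OF H] by simp
  next
    case (insert i I)
    have m: "(\<lambda>x. a i * h i x) \<in> H" using ax(3) insert.prems by blast
    have "ip (\<lambda>x. a i * h i x) g = a i * ip (h i) g" if "g \<in> H"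
      using ax(5) insert.prems that by blast
    then show ?case using insert ax(2)[OF m] ax(4)[OF m] by simp
  qed
  then show "(\<lambda>x. \<Sum>i\<in>I. a i * h i x) \<in> H"
    and "g \<in> H \<Longrightarrow> ip (\<lambda>x. \<Sum>i\<in>I. a i * h i x) g = (\<Sum>i\<in>I. a i * ip (h i) g)" by auto
qed

lemma hilbert_function_space_Cauchy_Schwarz:
  assumes H: "hilbert_function_space H ip" and f: "f \<in> H" and g: "g \<in> H"
  shows "cmod (ip f g) \<le> ip_norm ip f * ip_norm ip g"
proof -
  note inH = hilbert_function_space_rules(2,3)[OF H]
    and add = hilbert_function_space_rules(4)[OF H]
    and scal = hilbert_function_space_rules(5)[OF H]
    and cnj = hilbert_function_space_rules(6)[OF H]
    and pos = hilbert_function_space_rules(7)[OF H]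
    and nonneg = hilbert_function_space_ip_nonneg[OF H]
  have real: "ip h h = complex_of_real (Re (ip h h))" if "h \<in> H" for h
    using cnj[OF that that] by (simp add: complex_eq_iff)
  show ?thesis
  proof (cases "g = (\<lambda>x. 0)")
    case True
    have "ip f g = 0" using cnj[OF g f] hilbert_function_space_ip_zero[OF H f] unfolding True by simp
    then show ?thesis using nonneg[OF f] nonneg[OF g] by (simp add: ip_norm_def)
  next
    case False
    define p where "p = Re (ip g g)"
    define c where "c = ip f g"
    have p: "p > 0" "ip g g = of_real p" using pos[OF g False] real[OF g] by (auto simp: p_def)
    \<comment> \<open>\<open>h\<close> is \<open>p\<close> times the component of \<open>f\<close> orthogonal to \<open>g\<close>; its squared norm is nonnegative.\<close>
    define h where "h = (\<lambda>x. p * f x + (- c) * g x)"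
    have pf: "(\<lambda>x. p * f x) \<in> H" by (rule inH(2)[OF f])
    have cg: "(\<lambda>x. (- c) * g x) \<in> H" by (rule inH(2)[OF g])
    have hH: "h \<in> H" unfolding h_def by (rule inH(1)[OF pf cg])
    have hg: "ip h g = 0"
      unfolding h_def add[OF pf cg g] scal[OF f g] scal[OF g g] using p by (simp add: c_def)
    have "ip h h = p * ip f h - c * ip g h"
      using add[OF pf cg hH, folded h_def] unfolding scal[OF f hH] scal[OF g hH] by simp
    also have "ip g h = 0" using cnj[OF hH g] hg by simp
    also have "ip f h = cnj (ip h f)" using cnj[OF hH f] .
    also have "ip h f = p * ip f f - c * ip g f"
      unfolding h_def add[OF pf cg f] scal[OF f f] scal[OF g f] by simp
    also have "ip g f = cnj c" using cnj[OF f g] by (simp add: c_def)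
    finally have "ip h h = p * (p * cnj (ip f f) - c * cnj c)" by (simp add: algebra_simps)
    then have "Re (ip h h) = p * (p * Re (ip f f) - (cmod c)\<^sup>2)"
      unfolding complex_norm_square[symmetric] by (simp del: of_real_power)
    then have "p * Re (ip f f) - (cmod c)\<^sup>2 \<ge> 0"
      using nonneg[OF hH] p(1) by (simp add: zero_le_mult_iff)
    then have "cmod c \<le> sqrt (Re (ip f f) * p)"
      by (intro real_le_rsqrt) (simp add: mult.commute)
    then show ?thesis by (simp add: ip_norm_def c_def p_def real_sqrt_mult)
  qed
qed

text \<open>
  The representer of the functional \<open>f \<mapsto> \<Sum>i. a i f (s i)\<close> is \<open>\<Sum>i. cnj (a i) K (s i)\<close>; the double sum
  is its squared norm.
\<close>

lemma rkhs_functional_le: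
  assumes K: "is_rkhs K H ip" and f: "f \<in> H" and "finite I"
  shows "cmod (\<Sum>i\<in>I. a i * f (s i))
     \<le> ip_norm ip f * sqrt (Re (\<Sum>i\<in>I. \<Sum>k\<in>I. cnj (a i) * a k * K (s i) (s k)))"
proof -
  have H: "hilbert_function_space H ip" and KH: "\<And>t. K t \<in> H"
    and rep: "\<And>f t. f \<in> H \<Longrightarrow> f t = ip f (K t)"
    using K unfolding is_rkhs_def by auto
  have sym: "ip g f = cnj (ip f g)" if "f \<in> H" "g \<in> H" for f g
    using H that unfolding hilbert_function_space_def by blast
  define g where "g = (\<lambda>x. \<Sum>i\<in>I. cnj (a i) * K (s i) x)"
  have gH: "g \<in> H"
    unfolding g_def by (rule hilbert_function_space_sum(1)[OF H \<open>finite I\<close> KH])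
  have ipg: "ip g h = (\<Sum>i\<in>I. cnj (a i) * ip (K (s i)) h)" if "h \<in> H" for h
    unfolding g_def by (rule hilbert_function_space_sum(2)[OF H \<open>finite I\<close> KH that])
  have "ip f g = cnj (ip g f)" by (rule sym[OF gH f])
  also have "\<dots> = (\<Sum>i\<in>I. a i * cnj (ip (K (s i)) f))"
    unfolding ipg[OF f] by simp
  also have "\<dots> = (\<Sum>i\<in>I. a i * f (s i))"
    by (simp only: sym[OF KH f, symmetric] rep[OF f, symmetric])
  finally have 1: "(\<Sum>i\<in>I. a i * f (s i)) = ip f g" by simp
  have kernel_sym: "cnj (ip (K v) (K u)) = K u v" for u v
    using sym[OF KH[of v] KH[of u]] rep[OF KH[of u], of v] by simp
  have "ip (K (s i)) g = (\<Sum>k\<in>I. a k * K (s i) (s k))" for i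
  proof -
    have "ip (K (s i)) g = cnj (ip g (K (s i)))" by (rule sym[OF gH KH])
    also have "\<dots> = (\<Sum>k\<in>I. a k * cnj (ip (K (s k)) (K (s i))))"
      unfolding ipg[OF KH] by simp
    also have "\<dots> = (\<Sum>k\<in>I. a k * K (s i) (s k))"
      by (simp only: kernel_sym)
    finally show ?thesis .
  qed
  then have "ip g g = (\<Sum>i\<in>I. \<Sum>k\<in>I. cnj (a i) * a k * K (s i) (s k))"
    unfolding ipg[OF gH] by (simp add: sum_distrib_left mult.assoc)
  then show ?thesis
    using hilbert_function_space_Cauchy_Schwarz[OF H f gH] unfolding 1 by (simp add: ip_norm_def)
qed

text \<open>
  For a kernel with spectral density \<open>\<rho>\<close>, the double sum of the previous lemma is the integral of the
  squared modulus of the symbol \<open>\<xi> \<mapsto> \<Sum>i. a i exp (- \<i> s i \<xi>)\<close> against \<open>\<rho>\<close>. The points \<open>s i\<close> carry an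
  index, so that they may coincide: the evaluation point may itself be a sampling point.
\<close>

lemma spectral_rkhs_functional_le:
  fixes \<rho> :: "real \<Rightarrow> real" and s :: "'i \<Rightarrow> real" and a :: "'i \<Rightarrow> complex"
  assumes K: "is_rkhs K H ip" and f: "f \<in> H" and "finite I" and B: "0 \<le> B"
    and \<rho>: "integrable M \<rho>" "AE \<xi> in M. 0 \<le> \<rho> \<xi>" and M: "(\<lambda>\<xi>. \<xi>) \<in> borel_measurable M"
    and spec: "\<And>t \<tau>. K t \<tau> = (LINT \<xi>|M. exp (\<i> * complex_of_real ((t - \<tau>) * \<xi>)) * complex_of_real (\<rho> \<xi>))"
    and bound: "\<And>\<xi>. \<xi> \<in> space M \<Longrightarrow> cmod (\<Sum>i\<in>I. a i * exp (- \<i> * complex_of_real (s i * \<xi>))) \<le> B"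
  shows "cmod (\<Sum>i\<in>I. a i * f (s i)) \<le> ip_norm ip f * (B * sqrt (LINT \<xi>|M. \<bar>\<rho> \<xi>\<bar>))"
proof -
  define S where "S = (\<lambda>\<xi>. \<Sum>i\<in>I. a i * exp (- \<i> * complex_of_real (s i * \<xi>)))"
  have [measurable]: "\<rho> \<in> borel_measurable M" using \<rho>(1) by auto
  note M[measurable]
  have int: "integrable M (\<lambda>\<xi>. exp (\<i> * complex_of_real (u * \<xi>)) * complex_of_real (\<rho> \<xi>))" for u
    by (rule Bochner_Integration.integrable_bound[OF \<rho>(1)]) (auto simp: norm_mult)
  have SS: "complex_of_real ((cmod (S \<xi>))\<^sup>2 * \<rho> \<xi>)
     = (\<Sum>i\<in>I. \<Sum>k\<in>I. cnj (a i) * a k * (exp (\<i> * complex_of_real ((s i - s k) * \<xi>)) * complex_of_real (\<rho> \<xi>)))" for \<xi>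
  proof -
    have "cnj (exp (- \<i> * complex_of_real (s i * \<xi>))) * exp (- \<i> * complex_of_real (s k * \<xi>))
        = exp (\<i> * complex_of_real ((s i - s k) * \<xi>))" for i k
      by (simp add: exp_cnj exp_add[symmetric] algebra_simps)
    note e = this
    have "complex_of_real ((cmod (S \<xi>))\<^sup>2) = cnj (S \<xi>) * S \<xi>"
      by (metis complex_norm_square mult.commute)
    also have "\<dots> = (\<Sum>i\<in>I. \<Sum>k\<in>I. cnj (a i) * a k * exp (\<i> * complex_of_real ((s i - s k) * \<xi>)))"
      unfolding S_def cnj_sum sum_product e[symmetric] by (simp add: mult_ac)
    finally show ?thesis by (simp add: sum_distrib_right mult.assoc)
  qed
  have int': "integrable M (\<lambda>\<xi>. c * (exp (\<i> * complex_of_real (u * \<xi>)) * complex_of_real (\<rho> \<xi>)))" for u c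
    by (intro integrable_mult_right int)
  have "(\<Sum>i\<in>I. \<Sum>k\<in>I. cnj (a i) * a k * K (s i) (s k))
    = (\<Sum>i\<in>I. \<Sum>k\<in>I. LINT \<xi>|M. cnj (a i) * a k * (exp (\<i> * complex_of_real ((s i - s k) * \<xi>)) * complex_of_real (\<rho> \<xi>)))"
    by (simp only: integral_mult_right_zero spec)
  also have "\<dots> = (\<Sum>i\<in>I. LINT \<xi>|M. (\<Sum>k\<in>I. cnj (a i) * a k * (exp (\<i> * complex_of_real ((s i - s k) * \<xi>)) * complex_of_real (\<rho> \<xi>))))"
    by (intro sum.cong refl Bochner_Integration.integral_sum[symmetric] int')
  also have "\<dots> = (LINT \<xi>|M. complex_of_real ((cmod (S \<xi>))\<^sup>2 * \<rho> \<xi>))"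
    unfolding SS by (intro Bochner_Integration.integral_sum[symmetric] Bochner_Integration.integrable_sum int')
  also have "\<dots> = complex_of_real (LINT \<xi>|M. (cmod (S \<xi>))\<^sup>2 * \<rho> \<xi>)"
    by (rule integral_complex_of_real)
  finally have eq: "Re (\<Sum>i\<in>I. \<Sum>k\<in>I. cnj (a i) * a k * K (s i) (s k)) = (LINT \<xi>|M. (cmod (S \<xi>))\<^sup>2 * \<rho> \<xi>)"
    by simp
  also have "\<dots> \<le> (LINT \<xi>|M. B\<^sup>2 * \<bar>\<rho> \<xi>\<bar>)"
  proof (rule integral_mono_AE')
    show "integrable M (\<lambda>\<xi>. B\<^sup>2 * \<bar>\<rho> \<xi>\<bar>)" using \<rho>(1) by auto
    have "(cmod (S \<xi>))\<^sup>2 \<le> B\<^sup>2" if "\<xi> \<in> space M" for \<xi>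
      using bound[OF that] unfolding S_def by (intro power_mono) auto
    then have "(cmod (S \<xi>))\<^sup>2 * \<rho> \<xi> \<le> B\<^sup>2 * \<bar>\<rho> \<xi>\<bar>" if "\<xi> \<in> space M" "0 \<le> \<rho> \<xi>" for \<xi>
      unfolding abs_of_nonneg[OF that(2)] using that by (intro mult_right_mono)
    then show "AE \<xi> in M. (cmod (S \<xi>))\<^sup>2 * \<rho> \<xi> \<le> B\<^sup>2 * \<bar>\<rho> \<xi>\<bar>"
      by (intro AE_mp[OF \<rho>(2) AE_I2]) blast
  qed auto
  also have "\<dots> = B\<^sup>2 * (LINT \<xi>|M. \<bar>\<rho> \<xi>\<bar>)" by simp
  finally have "sqrt (Re (\<Sum>i\<in>I. \<Sum>k\<in>I. cnj (a i) * a k * K (s i) (s k))) \<le> B * sqrt (LINT \<xi>|M. \<bar>\<rho> \<xi>\<bar>)"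
    using real_sqrt_le_mono B by (fastforce simp: real_sqrt_mult)
  moreover have "ip_norm ip f \<ge> 0"
    using K f hilbert_function_space_ip_nonneg[of H ip f] unfolding ip_norm_def is_rkhs_def by simp
  ultimately show ?thesis
    using rkhs_functional_le[OF K f \<open>finite I\<close>, of a s]
    by (meson mult_left_mono order_trans)
qed

text \<open>
  The functional \<open>f \<mapsto> f t - f u\<close> has the symbol \<open>exp (- \<i> t \<xi>) - exp (- \<i> u \<xi>)\<close>, of modulus at most
  \<open>\<delta> \<bar>t - u\<bar>\<close>, so \<open>f\<close> is even Lipschitz continuous.
\<close>

lemma spectral_rkhs_continuous:
  fixes \<rho> :: "real \<Rightarrow> real"
  assumes K: "is_rkhs K H ip" and f: "f \<in> H" and \<delta>: "0 \<le> \<delta>"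
    and \<rho>: "integrable M \<rho>" "AE \<xi> in M. 0 \<le> \<rho> \<xi>" and M: "(\<lambda>\<xi>. \<xi>) \<in> borel_measurable M"
    and spec: "\<And>t \<tau>. K t \<tau> = (LINT \<xi>|M. exp (\<i> * complex_of_real ((t - \<tau>) * \<xi>)) * complex_of_real (\<rho> \<xi>))"
    and supp: "space M \<subseteq> {-\<delta>..\<delta>}"
  shows "continuous_on UNIV f"
proof -
  define L where "L = ip_norm ip f * (\<delta> * sqrt (LINT \<xi>|M. \<bar>\<rho> \<xi>\<bar>))"
  have lip: "dist (f t) (f u) \<le> L * dist t u" for t u
  proof -
    define s where "s = (\<lambda>b. if b then t else u)"
    define a where "a = (\<lambda>b. if b then 1 else - 1 :: complex)"
    have "cmod (\<Sum>b\<in>UNIV. a b * f (s b)) \<le> ip_norm ip f * ((\<delta> * \<bar>t - u\<bar>) * sqrt (LINT \<xi>|M. \<bar>\<rho> \<xi>\<bar>))"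
    proof (rule spectral_rkhs_functional_le[OF K f _ _ \<rho> M spec])
      fix \<xi> assume "\<xi> \<in> space M"
      then have "\<xi> \<in> {-\<delta>..\<delta>}" using supp by blast
      then have \<xi>: "\<bar>\<xi>\<bar> \<le> \<delta>" by auto
      have "(\<Sum>b\<in>UNIV. a b * exp (- \<i> * complex_of_real (s b * \<xi>))) =
          exp (\<i> * complex_of_real (- u * \<xi>)) * (exp (\<i> * complex_of_real (- (t - u) * \<xi>)) - 1)"
        by (simp add: UNIV_bool a_def s_def right_diff_distrib exp_add[symmetric] algebra_simps)
      then have "cmod (\<Sum>b\<in>UNIV. a b * exp (- \<i> * complex_of_real (s b * \<xi>)))
          = cmod (exp (\<i> * complex_of_real (- (t - u) * \<xi>)) - 1)"
        by (simp add: norm_mult)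
      also have "\<dots> \<le> \<bar>- (t - u) * \<xi>\<bar>"
        using iexp_approx1[of "- (t - u) * \<xi>" 0] by simp
      also have "\<dots> = \<bar>\<xi>\<bar> * \<bar>t - u\<bar>"
        by (simp add: abs_mult abs_minus_commute)
      also have "\<dots> \<le> \<delta> * \<bar>t - u\<bar>"
        using \<xi> by (intro mult_right_mono) auto
      finally show "cmod (\<Sum>b\<in>UNIV. a b * exp (- \<i> * complex_of_real (s b * \<xi>))) \<le> \<delta> * \<bar>t - u\<bar>" .
    qed (use \<delta> in auto)
    then show ?thesis by (simp add: UNIV_bool a_def s_def L_def dist_norm mult_ac norm_minus_commute)
  qed
  show ?thesis
  proof (rule continuous_on_subset[OF lipschitz_on_continuous_on])
    show "\<bar>L\<bar>-lipschitz_on UNIV f"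
      by (intro lipschitz_onI order_trans[OF lip] mult_right_mono) auto
  qed auto
qed

section \<open>The sampling map and its error\<close>

lemma continuous_gauss_sinc: "continuous_on UNIV (gauss_sinc \<alpha>)"
proof -
  have "isCont (\<lambda>x. sinc (pi * x)) x" for x
    by (rule isCont_o2[OF _ isCont_sinc]) auto
  then show ?thesis
    unfolding gauss_sinc_def
    by (intro continuous_at_imp_continuous_on ballI continuous_intros)
qed

definition gauss_sinc_sampling :: "real \<Rightarrow> nat \<Rightarrow> (int \<Rightarrow> complex) \<Rightarrow> real \<Rightarrow> complex" where
  "gauss_sinc_sampling \<alpha> n c t = (\<Sum>j\<in>J n. complex_of_real (gauss_sinc \<alpha> (t - of_int j)) * c j)"

lemma continuous_gauss_sinc_sampling: "continuous_on UNIV (gauss_sinc_sampling \<alpha> n c)"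
  unfolding gauss_sinc_sampling_def
  by (intro continuous_intros continuous_on_compose2[OF continuous_gauss_sinc]) auto

lemma Linf_norm_le:
  assumes "continuous_on {0..1} g" and "\<And>t. t \<in> {0..1} \<Longrightarrow> cmod (g t) \<le> B"
  shows "Linf_norm g \<le> ennreal B"
  unfolding Linf_norm_def
proof (rule esssup_I)
  have "g \<in> borel_measurable (lebesgue_on {0..1})"
    using assms(1) by (intro continuous_imp_measurable_on_sets_lebesgue) auto
  then show "(\<lambda>t. ennreal (cmod (g t))) \<in> borel_measurable (lebesgue_on {0..1})"
    by measurable
  show "AE t in lebesgue_on {0..1}. ennreal (cmod (g t)) \<le> ennreal B"
    using assms(2) by (intro AE_I2) (auto intro: ennreal_leI)
qed

lemma continuous_imp_Linf:
  assumes "continuous_on {0..1} g"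
  shows "g \<in> Linf"
proof -
  have "bounded (g ` {0..1})"
    using assms by (intro compact_imp_bounded compact_continuous_image) auto
  then obtain B where "\<forall>y\<in>g ` {0..1}. cmod y \<le> B"
    unfolding bounded_iff by blast
  then have "cmod (g t) \<le> B" if "t \<in> {0..1}" for t
    using that by blast
  then have "Linf_norm g \<le> ennreal B" by (rule Linf_norm_le[OF assms])
  also have "\<dots> < \<infinity>" by simp
  finally show ?thesis
    using assms unfolding Linf_def by (auto intro!: continuous_imp_measurable_on_sets_lebesgue)
qed

text \<open>
  The error at \<open>t\<close> is a functional of \<open>f\<close> whose symbol at \<open>\<xi>\<close> is the error of the sampling series on
  the pure frequency \<open>- \<xi>\<close>.
\<close>

lemma gauss_sinc_sampling_error_le:
  fixes \<rho> :: "real \<Rightarrow> real" and f :: "real \<Rightarrow> complex" and t \<delta> \<alpha> :: real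
  assumes K: "is_rkhs K H ip" and f: "f \<in> H" "ip_norm ip f \<le> 1"
    and \<delta>: "\<delta> < pi" and n: "n \<ge> 1" and \<alpha>: "\<alpha> = (pi - \<delta>) / (2 * real n)"
    and \<rho>: "integrable M \<rho>" "AE \<xi> in M. 0 \<le> \<rho> \<xi>" and M: "(\<lambda>\<xi>. \<xi>) \<in> borel_measurable M"
    and spec: "\<And>t \<tau>. K t \<tau> = (LINT \<xi>|M. exp (\<i> * complex_of_real ((t - \<tau>) * \<xi>)) * complex_of_real (\<rho> \<xi>))"
    and supp: "space M \<subseteq> {-\<delta>..\<delta>}" and t: "t \<in> {0..1}"
  shows "cmod (f t - gauss_sinc_sampling \<alpha> n (samples n f) t)
    \<le> (4 * sqrt (pi / \<alpha>) + 2 * (1 + 1 / (pi - \<delta>))) / (pi * n) * exp (- ((pi - \<delta>) / 2 * n))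
        * sqrt (LINT \<xi>|M. \<bar>\<rho> \<xi>\<bar>)"
    (is "_ \<le> ?B * sqrt ?R")
proof -
  define I where "I = insert None (Some ` J n)"
  define s where "s = (\<lambda>i. case i of None \<Rightarrow> t | Some j \<Rightarrow> real_of_int j)"
  define a where "a = (\<lambda>i. case i of None \<Rightarrow> 1 | Some j \<Rightarrow> - complex_of_real (gauss_sinc \<alpha> (t - of_int j)))"
  have finJ: "finite (J n)" by (simp add: J_def)
  have sumI: "(\<Sum>i\<in>I. a i * g (s i)) = g t - (\<Sum>j\<in>J n. complex_of_real (gauss_sinc \<alpha> (t - of_int j)) * g (of_int j))" for g :: "real \<Rightarrow> complex"
    unfolding I_def using finJ by (simp add: sum.reindex a_def s_def sum_negf)
  have B: "?B \<ge> 0" using \<delta> unfolding \<alpha> by simp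
  have "cmod (\<Sum>i\<in>I. a i * f (s i)) \<le> ip_norm ip f * (?B * sqrt ?R)"
  proof (rule spectral_rkhs_functional_le[OF K f(1) _ B \<rho> M spec])
    show "finite I" using finJ by (simp add: I_def)
    fix \<xi> assume "\<xi> \<in> space M"
    then have "\<xi> \<in> {-\<delta>..\<delta>}" using supp by blast
    then have \<xi>: "\<bar>- \<xi>\<bar> \<le> \<delta>" by auto
    have "(\<Sum>i\<in>I. a i * exp (- \<i> * complex_of_real (s i * \<xi>)))
       = exp (\<i> * of_real (- \<xi>) * t) - (\<Sum>j\<in>J n. gauss_sinc \<alpha> (t - j) * exp (\<i> * of_real (- \<xi>) * of_int j))"
      using sumI[of "\<lambda>x. exp (- \<i> * complex_of_real (x * \<xi>))"] by (simp add: mult_ac)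
    then show "cmod (\<Sum>i\<in>I. a i * exp (- \<i> * complex_of_real (s i * \<xi>))) \<le> ?B"
      using exp_gauss_sinc_error[OF \<delta> \<xi> _ _ n \<alpha>, of t] t by simp
  qed
  also have "\<dots> \<le> 1 * (?B * sqrt ?R)"
    by (intro mult_right_mono f(2) mult_nonneg_nonneg B) simp
  also have "(\<Sum>i\<in>I. a i * f (s i)) = f t - gauss_sinc_sampling \<alpha> n (samples n f) t"
    unfolding sumI gauss_sinc_sampling_def by (simp add: samples_def)
  finally show ?thesis by simp
qed

theorem theorem2p8:
  fixes \<delta> :: real and \<rho> :: "real \<Rightarrow> real"
    and P :: "'w measure" and X :: "real \<Rightarrow> 'w \<Rightarrow> complex"
    and H :: "(real \<Rightarrow> complex) set"
    and ip :: "(real \<Rightarrow> complex) \<Rightarrow> (real \<Rightarrow> complex) \<Rightarrow> complex"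
    and n :: nat
  assumes "0 < \<delta>" and "\<delta> < pi"
    and "integrable (lebesgue_on {-\<delta>..\<delta>}) \<rho>"
    and "AE \<xi> in lebesgue_on {-\<delta>..\<delta>}. 0 \<le> \<rho> \<xi>"
    and "\<not> (AE \<xi> in lebesgue_on {-\<delta>..\<delta>}. \<rho> \<xi> = 0)"
    and "wide_sense_stationary P X"
    and "\<And>t \<tau>. autocorrelation P X t \<tau> =
           (LINT \<xi>|lebesgue_on {-\<delta>..\<delta>}.
              exp (\<i> * complex_of_real ((t - \<tau>) * \<xi>)) * complex_of_real (\<rho> \<xi>))"
    and "is_rkhs (autocorrelation P X) H ip"
    and "1 \<le> n" and "real n \<ge> 4 / (pi - \<delta>)"
  shows "minimal_sampling_error H ip n \<le>
    ennreal (sqrt (LINT \<xi>|lebesgue_on {-\<delta>..\<delta>}. \<bar>\<rho> \<xi>\<bar>)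
      * (11 * exp 1 / (10 * sqrt pi))
      * (sqrt (pi - \<delta>) / 2 + 2 * sqrt 2 / sqrt (pi - \<delta>))
      * (1 / sqrt (real n)) * exp (- ((pi - \<delta>) / 2 * real n)))"
    (is "_ \<le> ennreal ?bound")
proof -
  define \<alpha> where "\<alpha> = (pi - \<delta>) / (2 * real n)"
  define A where "A = gauss_sinc_sampling \<alpha> n"
  have M: "(\<lambda>\<xi>. \<xi>) \<in> borel_measurable (lebesgue_on {-\<delta>..\<delta>})"
    by (intro continuous_imp_measurable_on_sets_lebesgue) auto
  have supp: "space (lebesgue_on {-\<delta>..\<delta>}) \<subseteq> {-\<delta>..\<delta>}" by simp
  have A: "A \<in> sampling_maps n"
    unfolding sampling_maps_def A_def
    by (auto intro!: continuous_imp_Linf continuous_on_subset[OF continuous_gauss_sinc_sampling])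
  have "Linf_norm (\<lambda>t. f t - A (samples n f) t) \<le> ennreal ?bound" if "f \<in> unit_ball H ip" for f
  proof (rule Linf_norm_le)
    have f: "f \<in> H" "ip_norm ip f \<le> 1" using that by (auto simp: unit_ball_def)
    have "continuous_on UNIV f"
      by (rule spectral_rkhs_continuous[OF assms(8) f(1) _ assms(3,4) M assms(7) supp]) (use assms(1) in simp)
    then show "continuous_on {0..1} (\<lambda>t. f t - A (samples n f) t)"
      unfolding A_def
      by (intro continuous_on_diff continuous_on_subset[OF continuous_gauss_sinc_sampling]) (auto intro: continuous_on_subset)
    fix t :: real assume t: "t \<in> {0..1}"
    have "cmod (f t - A (samples n f) t)
      \<le> (4 * sqrt (pi / \<alpha>) + 2 * (1 + 1 / (pi - \<delta>))) / (pi * n) * exp (- ((pi - \<delta>) / 2 * n))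
        * sqrt (LINT \<xi>|lebesgue_on {-\<delta>..\<delta>}. \<bar>\<rho> \<xi>\<bar>)"
      unfolding A_def
      by (rule gauss_sinc_sampling_error_le[OF assms(8) f assms(2,9) \<alpha>_def assms(3,4) M assms(7) supp t])
    also have "\<dots> \<le> (11 * exp 1 / (10 * sqrt pi) * (sqrt (pi - \<delta>) / 2 + 2 * sqrt 2 / sqrt (pi - \<delta>)) * (1 / sqrt n))
         * exp (- ((pi - \<delta>) / 2 * n)) * sqrt (LINT \<xi>|lebesgue_on {-\<delta>..\<delta>}. \<bar>\<rho> \<xi>\<bar>)"
      using assms(2,10) by (intro mult_right_mono sampling_constant_le[OF _ _ \<alpha>_def]) auto
    also have "\<dots> = ?bound" by (simp only: mult_ac)
    finally show "cmod (f t - A (samples n f) t) \<le> ?bound" .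
  qed
  then have "sampling_error H ip n A \<le> ennreal ?bound"
    unfolding sampling_error_def by (intro SUP_least)
  then show ?thesis
    unfolding minimal_sampling_error_def by (rule INF_lower2[OF A])
qed

end
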